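(* The following inequalities hold for the discrete Ricci curvature of the Hasse diagrams of the Bruhat orders of types $A$, $B$ and $D$: 1. for every $n\ge 2$, $\mathrm{Ric}(H(A_{n-1}))\geq -\left\lfloor \frac{n^2}{2}\right\rfloor-2n+8$; 2. for $2\le n\leq 5$, $\mathrm{Ric}(H(B_n))\geq 4(-2n+1)$; 3. for $n\geq 5$, $\mathrm{Ric}(H(B_n)) \geq -2\left\lfloor\frac{n^2}{2}\right\rfloor-2n+6$; 4. for every $n\ge 3$, $\mathrm{Ric}(H(D_n)) \geq -2\left\lfloor\frac{n^2}{2}\right\rfloor-2n+6$.
   Context: Ricci curvature. Let $G$ be a simple undirected graph (no loops, no multiple edges) that is locally finite and has no isolated vertices, with vertex set $\mathcal V(G)$; $B(1,x)$ is the set of neighbours of $x$. For real functions $f,g$ on $\mathcal V(G)$ and $x\in\mathcal V(G)$ put $\Delta(f)(x)=\sum_{v\in B(1,x)}(f(v)-f(x))$, $\Gamma(f,g)(x)=\frac12\sum_{v\in B(1,x)}(f(x)-f(v))(g(x)-g(v))$, $\Gamma(f)=\Gamma(f,f)$, and $\Gamma_2(f)(x)=\frac12\Delta(\Gamma(f,f))(x)-\Gamma(f,\Delta(f))(x)$. The discrete Ricci curvature $\mathrm{Ric}(G)$ is the maximum $K\in\mathbb R\cup\{-\infty\}$ such that $\Gamma_2(f)(x)\ge K\,\Gamma(f)(x)$ for every real function $f$ on $\mathcal V(G)$ and every vertex $x$. Bruhat order. For a Coxeter system $(W,S)$, $\ell$ is the length function with respect to $S$ and $T=\bigcup_{w\in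 W}wSw^{-1}$. The Bruhat order on $W$ is the partial order generated by the relations $tw<w$ for $w\in W$, $t\in T$ with $\ell(tw)<\ell(w)$. $H(W)$ is the undirected graph with vertex set $W$ in which two elements are joined by an edge iff one covers the other in the Bruhat order. Groups. $A_{n-1}=S_n$ with generators the adjacent transpositions. $B_n$ is the group of permutations $\pi$ of $\{\pm1,\ldots,\pm n\}$ with $\pi(-a)=-\pi(a)$, with generators $(1,-1)$ and $(i,i+1)(-i,-i-1)$, $1\le i\le n-1$. $D_n$ is the subgroup of those $\pi\in B_n$ with an even number of $i\in\{1,\ldots,n\}$ such that $\pi(i)<0$, with generators $(1,-2)(-1,2)$ and $(i,i+1)(-i,-i-1)$, $1\le i\le n-1$. *)

theory Defs
  imports "HOL-Library.Extended_Real" "HOL-Algebra.Sym_Groups"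
begin

section \<open>Discrete Ricci curvature of a graph\<close>

text \<open>A graph is a vertex set together with a set of two-element sets of vertices.\<close>

type_synonym 'a ugraph = "'a set \<times> 'a set set"

definition simple_ugraph :: "'a ugraph \<Rightarrow> bool" where
  "simple_ugraph G \<longleftrightarrow> (\<forall>e\<in>snd G. \<exists>x\<in>fst G. \<exists>y\<in>fst G. x \<noteq> y \<and> e = {x, y})"

definition nbrs :: "'a ugraph \<Rightarrow> 'a \<Rightarrow> 'a set" where
  "nbrs G x = {v. {x, v} \<in> snd G}"

definition locally_finite_ugraph :: "'a ugraph \<Rightarrow> bool" where
  "locally_finite_ugraph G \<longleftrightarrow> (\<forall>x\<in>fst G. finite (nbrs G x))"

definition no_isolated :: "'a ugraph \<Rightarrow> bool" where
  "no_isolated G \<longleftrightarrow> (\<forall>x\<in>fst G. nbrs G x \<noteq> {})"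

text \<open>Functions on the vertex set are total functions on the underlying type; all the operators
  below only use their values on vertices.\<close>

definition graph_laplacian :: "'a ugraph \<Rightarrow> ('a \<Rightarrow> real) \<Rightarrow> 'a \<Rightarrow> real" where
  "graph_laplacian G f x = (\<Sum>v\<in>nbrs G x. f v - f x)"

definition graph_Gamma :: "'a ugraph \<Rightarrow> ('a \<Rightarrow> real) \<Rightarrow> ('a \<Rightarrow> real) \<Rightarrow> 'a \<Rightarrow> real" where
  "graph_Gamma G f g x = 1/2 * (\<Sum>v\<in>nbrs G x. (f x - f v) * (g x - g v))"

definition graph_Gamma2 :: "'a ugraph \<Rightarrow> ('a \<Rightarrow> real) \<Rightarrow> 'a \<Rightarrow> real" where
  "graph_Gamma2 G f x =
     1/2 * graph_laplacian G (graph_Gamma G f f) x - graph_Gamma G f (graph_laplacian G f) x"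

definition curvature_ge :: "'a ugraph \<Rightarrow> real \<Rightarrow> bool" where
  "curvature_ge G K \<longleftrightarrow>
     (\<forall>f. \<forall>x\<in>fst G. graph_Gamma2 G f x \<ge> K * graph_Gamma G f f x)"

text \<open>The inequality for \<open>K = -\<infinity>\<close> is read as vacuously true, so the curvature is \<open>-\<infinity>\<close> exactly
  when no real \<open>K\<close> is admissible. That the supremum is a maximum for graphs without isolated
  vertices is shown in \<open>curvature_ge_iff_le_Ric\<close> and \<open>Ric_less_PInf\<close> below.\<close>

definition Ric :: "'a ugraph \<Rightarrow> ereal" where
  "Ric G = Sup {ereal K | K. curvature_ge G K}"

lemma graph_Gamma_nonneg: "graph_Gamma G f f x \<ge> 0"
  unfolding graph_Gamma_def by (simp add: sum_nonneg)

lemma curvature_ge_iff_le_Ric: "curvature_ge G K \<longleftrightarrow> ereal K \<le> Ric G"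
proof
  assume "curvature_ge G K"
  then show "ereal K \<le> Ric G"
    unfolding Ric_def by (intro Sup_upper) auto
next
  assume le: "ereal K \<le> Ric G"
  show "curvature_ge G K"
    unfolding curvature_ge_def
  proof (intro allI ballI)
    fix f x assume x: "x \<in> fst G"
    show "graph_Gamma2 G f x \<ge> K * graph_Gamma G f f x"
    proof (rule ccontr)
      assume less: "\<not> ?thesis"
      show False
      proof (cases "graph_Gamma G f f x = 0")
        case True
        have "{ereal K | K. curvature_ge G K} \<noteq> {}"
        proof
          assume "{ereal K | K. curvature_ge G K} = {}"
          then have "Ric G = -\<infinity>" unfolding Ric_def by (simp add: bot_ereal_def)
          with le show False by simp
        qed
        then obtain K0 where "curvature_ge G K0" by auto
        with x have "graph_Gamma2 G f x \<ge> K0 * graph_Gamma G f f x"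
          unfolding curvature_ge_def by blast
        with less True show False by simp
      next
        case False
        with graph_Gamma_nonneg[of G f x] have pos: "graph_Gamma G f f x > 0" by simp
        have "Ric G \<le> ereal (graph_Gamma2 G f x / graph_Gamma G f f x)"
          unfolding Ric_def
          by (intro Sup_least) (use x pos in \<open>auto simp: curvature_ge_def field_simps\<close>)
        with le have "K \<le> graph_Gamma2 G f x / graph_Gamma G f f x"
          using order_trans ereal_less_eq(3) by blast
        with less pos show False by (simp add: field_simps)
      qed
    qed
  qed
qed

lemma Ric_less_PInf:
  assumes "simple_ugraph G" "locally_finite_ugraph G" "no_isolated G" "fst G \<noteq> {}"
  shows "Ric G < \<infinity>"
proof -
  from assms(4) obtain x where x: "x \<in> fst G" by blast
  let ?f = "\<lambda>v. if v = x then 1 else 0 :: real"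
  have fin: "finite (nbrs G x)" and ne: "nbrs G x \<noteq> {}"
    using assms x by (auto simp: locally_finite_ugraph_def no_isolated_def)
  have irr: "v \<noteq> x" if "v \<in> nbrs G x" for v
    using that assms(1) by (force simp: nbrs_def simple_ugraph_def)
  have "(\<Sum>v\<in>nbrs G x. (?f x - ?f v) * (?f x - ?f v)) = (\<Sum>v\<in>nbrs G x. 1)"
    by (rule sum.cong) (use irr in auto)
  then have pos: "graph_Gamma G ?f ?f x > 0"
    unfolding graph_Gamma_def using fin ne by (simp add: card_gt_0_iff)
  have "Ric G \<le> ereal (graph_Gamma2 G ?f x / graph_Gamma G ?f ?f x)"
    unfolding Ric_def
    by (intro Sup_least) (use x pos in \<open>auto simp: curvature_ge_def field_simps\<close>)
  then show ?thesis by (rule le_less_trans) simp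
qed

section \<open>Bruhat order and its Hasse diagram\<close>

text \<open>Below, \<open>W\<close> is a group and \<open>S\<close> a set of involutions generating it, so words over \<open>S\<close> need no
  inverse letters.\<close>

definition cox_length :: "('a, 'b) monoid_scheme \<Rightarrow> 'a set \<Rightarrow> 'a \<Rightarrow> nat" where
  "cox_length W S w =
     (LEAST k. \<exists>ss. set ss \<subseteq> S \<and> length ss = k \<and> w = foldr (\<otimes>\<^bsub>W\<^esub>) ss \<one>\<^bsub>W\<^esub>)"

definition cox_reflections :: "('a, 'b) monoid_scheme \<Rightarrow> 'a set \<Rightarrow> 'a set" where
  "cox_reflections W S = {w \<otimes>\<^bsub>W\<^esub> s \<otimes>\<^bsub>W\<^esub> inv\<^bsub>W\<^esub> w | w s. w \<in> carrier W \<and> s \<in> S}"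

definition bruhat_gen :: "('a, 'b) monoid_scheme \<Rightarrow> 'a set \<Rightarrow> 'a rel" where
  "bruhat_gen W S = {(t \<otimes>\<^bsub>W\<^esub> w, w) | t w. w \<in> carrier W \<and> t \<in> cox_reflections W S \<and>
     cox_length W S (t \<otimes>\<^bsub>W\<^esub> w) < cox_length W S w}"

definition bruhat_le :: "('a, 'b) monoid_scheme \<Rightarrow> 'a set \<Rightarrow> 'a \<Rightarrow> 'a \<Rightarrow> bool" where
  "bruhat_le W S x y \<longleftrightarrow> x \<in> carrier W \<and> y \<in> carrier W \<and> (x, y) \<in> (bruhat_gen W S)\<^sup>*"

definition bruhat_less :: "('a, 'b) monoid_scheme \<Rightarrow> 'a set \<Rightarrow> 'a \<Rightarrow> 'a \<Rightarrow> bool" where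
  "bruhat_less W S x y \<longleftrightarrow> bruhat_le W S x y \<and> x \<noteq> y"

definition bruhat_covers :: "('a, 'b) monoid_scheme \<Rightarrow> 'a set \<Rightarrow> 'a \<Rightarrow> 'a \<Rightarrow> bool" where
  "bruhat_covers W S x y \<longleftrightarrow>
     bruhat_less W S x y \<and> \<not> (\<exists>z. bruhat_less W S x z \<and> bruhat_less W S z y)"

definition bruhat_hasse :: "('a, 'b) monoid_scheme \<Rightarrow> 'a set \<Rightarrow> 'a ugraph" where
  "bruhat_hasse W S = (carrier W, {{x, y} | x y. bruhat_covers W S x y})"

section \<open>The groups of types A, B and D\<close>

text \<open>The symmetric group on \<open>{1..n}\<close>, i.e. type \<open>A\<close> of rank \<open>n - 1\<close>, is the library's \<open>sym_group n\<close>.\<close>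

definition sym_gens :: "nat \<Rightarrow> (nat \<Rightarrow> nat) set" where
  "sym_gens n = {transpose i (i + 1) | i. 1 \<le> i \<and> i + 1 \<le> n}"

definition signed_set :: "nat \<Rightarrow> int set" where
  "signed_set n = {- int n..int n} - {0}"

definition signed_sym_group :: "nat \<Rightarrow> (int \<Rightarrow> int) monoid" where
  "signed_sym_group n =
     \<lparr>carrier = {\<pi>. \<pi> permutes signed_set n \<and> (\<forall>a\<in>signed_set n. \<pi> (- a) = - \<pi> a)},
      mult = (\<circ>), one = id\<rparr>"

definition signed_adj :: "int \<Rightarrow> int \<Rightarrow> int" where
  "signed_adj i = transpose i (i + 1) \<circ> transpose (- i) (- i - 1)"

definition signed_sym_gens :: "nat \<Rightarrow> (int \<Rightarrow> int) set" where
  "signed_sym_gens n =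
     insert (transpose 1 (- 1)) {signed_adj i | i. 1 \<le> i \<and> i \<le> int n - 1}"

definition even_signed_sym_group :: "nat \<Rightarrow> (int \<Rightarrow> int) monoid" where
  "even_signed_sym_group n =
     \<lparr>carrier = {\<pi> \<in> carrier (signed_sym_group n). even (card {i\<in>{1..int n}. \<pi> i < 0})},
      mult = (\<circ>), one = id\<rparr>"

definition even_signed_sym_gens :: "nat \<Rightarrow> (int \<Rightarrow> int) set" where
  "even_signed_sym_gens n =
     insert (transpose 1 (- 2) \<circ> transpose (- 1) 2) {signed_adj i | i. 1 \<le> i \<and> i \<le> int n - 1}"

definition H_A :: "nat \<Rightarrow> (nat \<Rightarrow> nat) ugraph" where
  "H_A n = bruhat_hasse (sym_group n) (sym_gens n)"

definition H_B :: "nat \<Rightarrow> (int \<Rightarrow> int) ugraph" where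
  "H_B n = bruhat_hasse (signed_sym_group n) (signed_sym_gens n)"

definition H_D :: "nat \<Rightarrow> (int \<Rightarrow> int) ugraph" where
  "H_D n = bruhat_hasse (even_signed_sym_group n) (even_signed_sym_gens n)"

end

theory Submission
  imports Defs
begin

text \<open>
  The curvature of a graph is controlled by its vertex degrees alone. Write \<open>h v = f v - f x\<close>. A
  completion of squares turns \<open>2 * \<Gamma>\<^sub>2(f)(x)\<close> into a sum of squares plus
  \<open>1/2 * (\<Sum>v. (4 - d x - d v) * (h v)\<^sup>2)\<close>, where \<open>v\<close> runs over the neighbours of \<open>x\<close> and \<open>d\<close> is
  the degree (lemma \<open>two_Gamma2_eq\<close>). As \<open>2 * \<Gamma>(f)(x) = (\<Sum>v. (h v)\<^sup>2)\<close>, a graph whose degrees are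
  at most \<open>N\<close> has curvature at least \<open>2 - N\<close>.

  In the Hasse diagram of a Bruhat order a cover relation \<open>x < y\<close> has the form \<open>x = t y\<close> with a
  reflection \<open>t\<close>, so a degree is at most the number of reflections. This number is at most
  \<open>n (n - 1) / 2\<close> in type \<open>A\<close>, namely the number of transpositions, and at most \<open>n\<^sup>2\<close> in types \<open>B\<close>
  and \<open>D\<close>, the reflections of \<open>D\<^sub>n\<close> being reflections of \<open>B\<^sub>n\<close>. These counts are small enough for
  all the asserted inequalities but one: for \<open>S\<^sub>2\<close> the graph is a single edge, and the square
  \<open>(\<Sum>v. h v)\<^sup>2\<close> has to be kept, which raises the bound from \<open>1\<close> to \<open>2\<close>.
\<close>

section \<open>Curvature and vertex degrees\<close>

text \<open>For a neighbour \<open>v\<close> of \<open>x\<close> the contribution of an edge from \<open>v\<close> to \<open>u\<close> is a quadratic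
  polynomial in \<open>f u - f x\<close> with leading coefficient \<open>1/2\<close>. Completing its square leaves
  \<open>- (h v)\<^sup>2 / 2\<close> for each \<open>u\<close>, which is where the degree of \<open>v\<close> enters; the edge back to \<open>x\<close>, on
  which \<open>f u - f x\<close> vanishes, is kept apart because it contributes positively.\<close>

lemma two_Gamma2_eq:
  assumes finx: "finite (nbrs G x)"
    and fin: "\<And>v. v \<in> nbrs G x \<Longrightarrow> finite (nbrs G v)"
  shows "2 * graph_Gamma2 G f x =
    (\<Sum>v\<in>nbrs G x. f v - f x)\<^sup>2
    + 1/2 * (\<Sum>v\<in>nbrs G x. (4 - real (card (nbrs G x)) - real (card (nbrs G v))) * (f v - f x)\<^sup>2)
    + 1/2 * (\<Sum>v\<in>nbrs G x. \<Sum>u\<in>nbrs G v - {x}. (f u - f x - 2 * (f v - f x))\<^sup>2)"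
proof -
  define h where "h v = f v - f x" for v
  define s where "s = (\<Sum>v\<in>nbrs G x. h v)"
  define Q where "Q = (\<Sum>v\<in>nbrs G x. (h v)\<^sup>2)"
  define E where "E v = (\<Sum>u\<in>nbrs G v - {x}. (f u - f x - 2 * (f v - f x))\<^sup>2)" for v
  let ?d = "\<lambda>v. real (card (nbrs G v))"
  have Gx: "graph_Gamma G f f x = Q / 2"
    by (simp add: graph_Gamma_def Q_def h_def power2_commute[of "f x"] flip: power2_eq_square)
  have Lx: "graph_laplacian G f x = s"
    by (simp add: graph_laplacian_def s_def h_def)
  have local: "graph_Gamma G f f v - h v * graph_laplacian G f v
      = (2 - ?d v / 2) * (h v)\<^sup>2 + 1/2 * E v" if v: "v \<in> nbrs G x" for v
  proof -
    let ?q = "\<lambda>u. 1/2 * ((f v - f u) * (f v - f u)) - h v * (f u - f v)"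
    have xv: "x \<in> nbrs G v" using v by (simp add: nbrs_def insert_commute)
    have "?d v = real (card (nbrs G v - {x})) + 1"
      using card_Suc_Diff1[OF fin[OF v] xv] by linarith
    then have card: "real (card (nbrs G v - {x})) = ?d v - 1" by simp
    have "graph_Gamma G f f v - h v * graph_laplacian G f v = (\<Sum>u\<in>nbrs G v. ?q u)"
      unfolding graph_Gamma_def graph_laplacian_def sum_distrib_left by (rule sum_subtractf[symmetric])
    also have "\<dots> = ?q x + (\<Sum>u\<in>nbrs G v - {x}. ?q u)"
      by (rule sum.remove[OF fin[OF v] xv])
    also have "?q x = 3/2 * (h v)\<^sup>2"
      by (simp add: h_def power2_eq_square algebra_simps)
    also have "(\<Sum>u\<in>nbrs G v - {x}. ?q u) = (\<Sum>u\<in>nbrs G v - {x}.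
        1/2 * (f u - f x - 2 * (f v - f x))\<^sup>2 - 1/2 * (h v)\<^sup>2)"
      by (intro sum.cong refl) (simp add: h_def power2_eq_square field_simps)
    also have "\<dots> = 1/2 * E v - (?d v - 1) * (1/2 * (h v)\<^sup>2)"
      by (simp add: E_def sum_subtractf sum_distrib_left card)
    finally show ?thesis by (simp add: field_simps)
  qed
  have "2 * graph_Gamma2 G f x
      = (\<Sum>v\<in>nbrs G x. graph_Gamma G f f v - Q / 2)
        - (\<Sum>v\<in>nbrs G x. (f x - f v) * (s - graph_laplacian G f v))"
    by (simp add: graph_Gamma2_def graph_laplacian_def[of G "graph_Gamma G f f"]
        graph_Gamma_def[of G f "graph_laplacian G f"] Gx Lx)
  also have "\<dots> = (\<Sum>v\<in>nbrs G x. (graph_Gamma G f f v - h v * graph_laplacian G f v)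
      + h v * s - Q / 2)"
    by (simp add: sum_subtractf[symmetric] h_def algebra_simps)
  also have "\<dots> = (\<Sum>v\<in>nbrs G x. (2 - ?d v / 2) * (h v)\<^sup>2 + 1/2 * E v + h v * s - Q / 2)"
    by (intro sum.cong refl) (simp add: local)
  also have "\<dots> = (\<Sum>v\<in>nbrs G x. (2 - ?d v / 2) * (h v)\<^sup>2) + 1/2 * (\<Sum>v\<in>nbrs G x. E v)
      + s * s - ?d x * Q / 2"
    by (simp add: sum.distrib sum_subtractf sum_distrib_left[symmetric]
        sum_distrib_right[symmetric] s_def[symmetric] sum_divide_distrib[symmetric])
  also have "?d x * Q / 2 = (\<Sum>v\<in>nbrs G x. ?d x / 2 * (h v)\<^sup>2)"
    by (simp add: Q_def sum_distrib_left sum_divide_distrib)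
  also have "(\<Sum>v\<in>nbrs G x. (2 - ?d v / 2) * (h v)\<^sup>2) + 1/2 * (\<Sum>v\<in>nbrs G x. E v)
      + s * s - (\<Sum>v\<in>nbrs G x. ?d x / 2 * (h v)\<^sup>2)
      = s\<^sup>2 + ((\<Sum>v\<in>nbrs G x. (2 - ?d v / 2) * (h v)\<^sup>2) - (\<Sum>v\<in>nbrs G x. ?d x / 2 * (h v)\<^sup>2))
      + 1/2 * (\<Sum>v\<in>nbrs G x. E v)"
    by (simp add: power2_eq_square)
  also have "(\<Sum>v\<in>nbrs G x. (2 - ?d v / 2) * (h v)\<^sup>2) - (\<Sum>v\<in>nbrs G x. ?d x / 2 * (h v)\<^sup>2)
      = 1/2 * (\<Sum>v\<in>nbrs G x. (4 - ?d x - ?d v) * (h v)\<^sup>2)"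
    unfolding sum_subtractf[symmetric] sum_distrib_left
    by (intro sum.cong refl) (simp add: field_simps)
  finally show ?thesis by (simp add: s_def h_def E_def)
qed

lemma two_Gamma2_ge:
  assumes fin: "\<And>v. finite (nbrs G v)" and deg: "\<And>v. card (nbrs G v) \<le> N"
  shows "2 * graph_Gamma2 G f x \<ge>
    (\<Sum>v\<in>nbrs G x. f v - f x)\<^sup>2 + (2 - real N) * (\<Sum>v\<in>nbrs G x. (f v - f x)\<^sup>2)"
proof -
  have "(2 - real N) * (\<Sum>v\<in>nbrs G x. (f v - f x)\<^sup>2)
      = 1/2 * (\<Sum>v\<in>nbrs G x. (4 - real N - real N) * (f v - f x)\<^sup>2)"
    by (simp add: sum_distrib_left[symmetric])
  also have "\<dots> \<le> 1/2 * (\<Sum>v\<in>nbrs G x.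
      (4 - real (card (nbrs G x)) - real (card (nbrs G v))) * (f v - f x)\<^sup>2)"
  proof (intro mult_left_mono sum_mono mult_right_mono)
    fix v
    show "4 - real N - real N \<le> 4 - real (card (nbrs G x)) - real (card (nbrs G v))"
      using deg[of x] deg[of v] by linarith
  qed auto
  finally have "(2 - real N) * (\<Sum>v\<in>nbrs G x. (f v - f x)\<^sup>2) \<le> \<dots>" .
  moreover have "0 \<le> (\<Sum>v\<in>nbrs G x. \<Sum>u\<in>nbrs G v - {x}. (f u - f x - 2 * (f v - f x))\<^sup>2)"
    by (intro sum_nonneg) simp
  ultimately show ?thesis
    unfolding two_Gamma2_eq[of G x f, OF fin fin] by simp
qed

lemma two_Gamma_eq: "2 * graph_Gamma G f f x = (\<Sum>v\<in>nbrs G x. (f v - f x)\<^sup>2)"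
  by (simp add: graph_Gamma_def power2_commute[of "f x"] flip: power2_eq_square)

lemma curvature_ge_two_minus_degree:
  assumes "\<And>v. finite (nbrs G v)" and "\<And>v. card (nbrs G v) \<le> N" and "K \<le> 2 - real N"
  shows "curvature_ge G K"
  unfolding curvature_ge_def
proof (intro allI ballI)
  fix f x
  have "K * (2 * graph_Gamma G f f x) \<le> (2 - real N) * (2 * graph_Gamma G f f x)"
    by (intro mult_right_mono) (use assms(3) graph_Gamma_nonneg[of G f x] in auto)
  also have "\<dots> \<le> 2 * graph_Gamma2 G f x"
    using two_Gamma2_ge[of G N f x, OF assms(1,2)] zero_le_power2[of "\<Sum>v\<in>nbrs G x. f v - f x"]
    unfolding two_Gamma_eq by linarith
  finally show "K * graph_Gamma G f f x \<le> graph_Gamma2 G f x" by simp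
qed

text \<open>With at most one neighbour the square of the sum is the sum of the squares, a gain of \<open>1\<close>
  over the general bound.\<close>

lemma curvature_ge_two_of_degree_le_1:
  assumes fin: "\<And>v. finite (nbrs G v)" and deg: "\<And>v. card (nbrs G v) \<le> 1"
  shows "curvature_ge G 2"
  unfolding curvature_ge_def
proof (intro allI ballI)
  fix f x
  have "nbrs G x = {} \<or> (\<exists>v. nbrs G x = {v})"
    using deg[of x] fin[of x] by (metis card_0_eq card_1_singletonE le_neq_implies_less less_one)
  then have "(\<Sum>v\<in>nbrs G x. f v - f x)\<^sup>2 = 2 * graph_Gamma G f f x"
    unfolding two_Gamma_eq by auto
  with two_Gamma2_ge[of G 1 f x, OF fin deg]
  show "2 * graph_Gamma G f f x \<le> graph_Gamma2 G f x"
    unfolding two_Gamma_eq[symmetric] by simp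
qed

section \<open>Degrees in the Hasse diagram of a Bruhat order\<close>

text \<open>A chain of generating relations from \<open>x\<close> to \<open>y\<close> passes only through elements between \<open>x\<close>
  and \<open>y\<close>, so for a cover it consists of a single relation.\<close>

lemma bruhat_covers_imp_gen:
  assumes "bruhat_covers W S x y"
  shows "(x, y) \<in> bruhat_gen W S"
proof -
  have less: "bruhat_less W S x y" and
    none: "\<And>z. bruhat_less W S x z \<Longrightarrow> bruhat_less W S z y \<Longrightarrow> False"
    using assms by (auto simp: bruhat_covers_def)
  then have xy: "(x, y) \<in> (bruhat_gen W S)\<^sup>*" "x \<noteq> y" "x \<in> carrier W" "y \<in> carrier W"
    by (auto simp: bruhat_less_def bruhat_le_def)
  from xy(1,2) obtain z where z: "(x, z) \<in> bruhat_gen W S" "(z, y) \<in> (bruhat_gen W S)\<^sup>*"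
    by (meson converse_rtranclE)
  have zc: "z \<in> carrier W" and xz: "x \<noteq> z"
    using z(1) by (auto simp: bruhat_gen_def)
  have "z = y"
  proof (rule ccontr)
    assume "z \<noteq> y"
    then show False
      using none[of z] z zc xz xy by (auto simp: bruhat_less_def bruhat_le_def)
  qed
  with z show ?thesis by simp
qed

text \<open>The reflections are compared with a set \<open>R\<close> of involutions, so that \<open>x = t \<circ> v\<close> and
  \<open>v = t \<circ> x\<close> are the same relation.\<close>

lemma nbrs_bruhat_hasse_subset:
  assumes mult: "mult W = (\<circ>)"
    and refl: "cox_reflections W S \<subseteq> R" and invol: "\<And>t. t \<in> R \<Longrightarrow> t \<circ> t = id"
  shows "nbrs (bruhat_hasse W S) x \<subseteq> (\<lambda>t. t \<circ> x) ` R"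
proof
  fix v assume "v \<in> nbrs (bruhat_hasse W S) x"
  then have "bruhat_covers W S x v \<or> bruhat_covers W S v x"
    by (auto simp: nbrs_def bruhat_hasse_def doubleton_eq_iff)
  then have "(x, v) \<in> bruhat_gen W S \<or> (v, x) \<in> bruhat_gen W S"
    by (auto dest: bruhat_covers_imp_gen)
  then obtain t where t: "t \<in> R" "x = t \<circ> v \<or> v = t \<circ> x"
    using refl mult by (auto simp: bruhat_gen_def)
  have "t \<circ> (t \<circ> v) = v"
    using invol[OF t(1)] by (simp add: comp_assoc[symmetric])
  with t(2) have "v = t \<circ> x" by auto
  then show "v \<in> (\<lambda>t. t \<circ> x) ` R" by (intro rev_image_eqI[OF t(1)]) simp
qed

lemma card_nbrs_bruhat_hasse:
  assumes "mult W = (\<circ>)" and "cox_reflections W S \<subseteq> R" and "\<And>t. t \<in> R \<Longrightarrow> t \<circ> t = id"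
    and fin: "finite R" and card: "card R \<le> N"
  shows "finite (nbrs (bruhat_hasse W S) x)" and "card (nbrs (bruhat_hasse W S) x) \<le> N"
proof -
  note sub = nbrs_bruhat_hasse_subset[OF assms(1-3), of x]
  show "finite (nbrs (bruhat_hasse W S) x)"
    using sub fin finite_subset by blast
  have "card (nbrs (bruhat_hasse W S) x) \<le> card R"
    by (rule surj_card_le[OF fin sub])
  with card show "card (nbrs (bruhat_hasse W S) x) \<le> N" by simp
qed

section \<open>Conjugation in permutation groups\<close>

lemma m_inv_comp_eq_inv:
  assumes "mult W = (\<circ>)" "one W = id" "bij w" "inv' w \<in> carrier W"
  shows "m_inv W w = inv' w"
proof -
  have uniq: "y = inv' w" if "y \<circ> w = id" for y
    using that assms(3) by (metis bij_is_surj comp_assoc comp_id id_comp surj_iff)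
  show ?thesis
    unfolding m_inv_def using assms uniq
    by (intro the_equality) (auto simp: bij_is_inj bij_is_surj surj_iff[symmetric])
qed

lemma bij_conj_transpose:
  assumes "bij w"
  shows "w \<circ> transpose a b \<circ> inv' w = transpose (w a) (w b)"
proof
  fix y
  obtain z where "y = w z" using assms by (metis bij_pointE)
  then show "(w \<circ> transpose a b \<circ> inv' w) y = transpose (w a) (w b) y"
    using assms by (auto simp: transpose_def bij_is_inj inj_eq)
qed

lemma conj_comp:
  assumes "bij w"
  shows "w \<circ> (g \<circ> h) \<circ> inv' w = (w \<circ> g \<circ> inv' w) \<circ> (w \<circ> h \<circ> inv' w)"
  using assms by (simp add: fun_eq_iff bij_is_inj)

section \<open>Type A\<close>

definition transpositions :: "nat \<Rightarrow> (nat \<Rightarrow> nat) set" where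
  "transpositions n = (\<lambda>A. transpose (Min A) (Max A)) ` {A. A \<subseteq> {1..n} \<and> card A = 2}"

lemma transpose_in_transpositions:
  assumes "a \<in> {1..n}" "b \<in> {1..n}" "a \<noteq> b"
  shows "transpose a b \<in> transpositions n"
proof -
  have "transpose a b = transpose (Min {a, b}) (Max {a, b})"
    by (cases "a \<le> b") (auto simp: transpose_commute)
  then show ?thesis
    unfolding transpositions_def using assms by (intro image_eqI[of _ _ "{a, b}"]) auto
qed

lemma finite_transpositions: "finite (transpositions n)"
  unfolding transpositions_def by simp

lemma card_transpositions_le: "card (transpositions n) \<le> n choose 2"
proof -
  have "card (transpositions n) \<le> card {A. A \<subseteq> {1..n} \<and> card A = 2}"
    unfolding transpositions_def by (rule card_image_le) simp
  also have "\<dots> = n choose 2" using n_subsets[of "{1..n}" 2] by simp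
  finally show ?thesis .
qed

lemma reflections_sym_group: "cox_reflections (sym_group n) (sym_gens n) \<subseteq> transpositions n"
proof
  fix t assume "t \<in> cox_reflections (sym_group n) (sym_gens n)"
  then obtain w i where w: "w permutes {1..n}" and i: "1 \<le> i" "i + 1 \<le> n"
    and t: "t = w \<circ> transpose i (i + 1) \<circ> m_inv (sym_group n) w"
    by (auto simp: cox_reflections_def sym_gens_def sym_group_def)
  have bij: "bij w" using w by (rule permutes_bij)
  have "m_inv (sym_group n) w = inv' w"
    using w by (intro m_inv_comp_eq_inv) (auto simp: sym_group_def permutes_bij permutes_inv)
  then have "t = transpose (w i) (w (i + 1))"
    using t bij_conj_transpose[OF bij] by simp
  moreover have "w i \<in> {1..n}" "w (i + 1) \<in> {1..n}"
    unfolding permutes_in_image[OF w] using i by auto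
  moreover have "w i \<noteq> w (i + 1)"
    using inj_eq[OF bij_is_inj[OF bij], of i "i + 1"] by simp
  ultimately show "t \<in> transpositions n"
    using transpose_in_transpositions by blast
qed

lemma degree_H_A:
  shows "finite (nbrs (H_A n) v)" and "card (nbrs (H_A n) v) \<le> n choose 2"
proof -
  have "t \<circ> t = id" if "t \<in> transpositions n" for t
    using that by (auto simp: transpositions_def)
  note * = card_nbrs_bruhat_hasse[OF _ reflections_sym_group this finite_transpositions
      card_transpositions_le]
  show "finite (nbrs (H_A n) v)" and "card (nbrs (H_A n) v) \<le> n choose 2"
    unfolding H_A_def by (rule *; simp add: sym_group_def)+
qed

section \<open>Types B and D\<close>

definition signed_swap :: "int \<Rightarrow> int \<Rightarrow> int \<Rightarrow> int" where
  "signed_swap a b = transpose a b \<circ> transpose (- a) (- b)"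

lemma signed_swap_commute: "signed_swap a b = signed_swap b a"
  by (simp add: signed_swap_def transpose_commute)

lemma signed_swap_apply:
  assumes "\<bar>a\<bar> \<noteq> \<bar>b\<bar>" "a \<noteq> 0" "b \<noteq> 0"
  shows "signed_swap a b x =
    (if x = a then b else if x = b then a else if x = - a then - b else if x = - b then - a else x)"
proof -
  have ne: "a \<noteq> b" "a \<noteq> - b" "- a \<noteq> b" "a \<noteq> - a" "b \<noteq> - b"
    using assms by auto
  show ?thesis
  proof (cases "x = - a \<or> x = - b")
    case True
    then show ?thesis using ne ne[symmetric]
      by (elim disjE) (simp_all add: signed_swap_def transpose_def)
  next
    case False
    then show ?thesis by (simp add: signed_swap_def transpose_def)
  qed
qed

lemma signed_swap_minus:
  assumes "\<bar>a\<bar> \<noteq> \<bar>b\<bar>" "a \<noteq> 0" "b \<noteq> 0"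
  shows "signed_swap (- a) (- b) = signed_swap a b"
proof
  fix x
  have "\<bar>- a\<bar> \<noteq> \<bar>- b\<bar>" "- a \<noteq> 0" "- b \<noteq> 0" using assms by simp_all
  from signed_swap_apply[OF this, of x] signed_swap_apply[OF assms, of x]
  show "signed_swap (- a) (- b) x = signed_swap a b x"
    using assms by (simp split: if_splits)
qed

lemma signed_swap_involutory:
  assumes "\<bar>a\<bar> \<noteq> \<bar>b\<bar>" "a \<noteq> 0" "b \<noteq> 0"
  shows "signed_swap a b \<circ> signed_swap a b = id"
proof
  fix x
  have ne: "a \<noteq> b" "a \<noteq> - b" "- a \<noteq> b" "a \<noteq> - a" "b \<noteq> - b"
    using assms by auto
  consider "x = a" | "x = b" | "x = - a" | "x = - b" | "x \<notin> {a, b, - a, - b}" by blast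
  then show "(signed_swap a b \<circ> signed_swap a b) x = id x"
    by cases (use ne ne[symmetric] in \<open>simp_all add: signed_swap_apply[OF assms]\<close>)
qed

lemma signed_adj_eq_signed_swap: "signed_adj i = signed_swap i (i + 1)"
  by (simp add: signed_adj_def signed_swap_def)

text \<open>A pair \<open>i < j\<close> encodes the swap of \<open>i\<close> and \<open>j\<close>, a pair \<open>i > j\<close> the swap of \<open>i\<close> and \<open>- j\<close>, and
  the diagonal the sign changes, so that the \<open>n\<^sup>2\<close> pairs enumerate the reflections of \<open>B\<^sub>n\<close>.\<close>

definition signed_reflection :: "int \<Rightarrow> int \<Rightarrow> int \<Rightarrow> int" where
  "signed_reflection i j =
     (if i = j then transpose i (- i) else signed_swap i (if i < j then j else - j))"

definition signed_reflections :: "nat \<Rightarrow> (int \<Rightarrow> int) set" where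
  "signed_reflections n = (\<lambda>(i, j). signed_reflection i j) ` ({1..int n} \<times> {1..int n})"

lemma signed_reflections_involutory:
  assumes "t \<in> signed_reflections n"
  shows "t \<circ> t = id"
proof -
  obtain i j where ij: "i \<ge> 1" "j \<ge> 1" "t = signed_reflection i j"
    using assms by (auto simp: signed_reflections_def)
  then show ?thesis
    by (auto simp: signed_reflection_def signed_swap_involutory)
qed

lemma finite_signed_reflections: "finite (signed_reflections n)"
  unfolding signed_reflections_def by simp

lemma card_signed_reflections_le: "card (signed_reflections n) \<le> n * n"
proof -
  have "card (signed_reflections n) \<le> card ({1..int n} \<times> {1..int n})"
    unfolding signed_reflections_def by (rule card_image_le) simp
  then show ?thesis by (simp add: card_cartesian_product)
qed

lemma sign_change_in_signed_reflections:
  assumes "a \<in> signed_set n"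
  shows "transpose a (- a) \<in> signed_reflections n"
proof -
  have "transpose a (- a) = signed_reflection \<bar>a\<bar> \<bar>a\<bar>"
    by (auto simp: signed_reflection_def abs_if transpose_commute)
  moreover have "(\<bar>a\<bar>, \<bar>a\<bar>) \<in> {1..int n} \<times> {1..int n}"
    using assms by (auto simp: signed_set_def)
  ultimately show ?thesis
    unfolding signed_reflections_def by (intro image_eqI) auto
qed

lemma signed_swap_in_signed_reflections:
  assumes "a \<in> signed_set n" "b \<in> signed_set n" "\<bar>a\<bar> \<noteq> \<bar>b\<bar>"
  shows "signed_swap a b \<in> signed_reflections n"
proof -
  have ordered: "signed_swap c d \<in> signed_reflections n"
    if cd: "c \<in> signed_set n" "d \<in> signed_set n" "\<bar>c\<bar> < \<bar>d\<bar>" for c d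
  proof -
    have nz: "c \<noteq> 0" "d \<noteq> 0" using cd by (auto simp: signed_set_def)
    have neg: "signed_swap (- c) (- d) = signed_swap c d"
      using signed_swap_minus[of c d] cd nz by simp
    (* With equal signs the swap is that of the absolute values; with opposite signs it is
       that of the larger absolute value and the negative of the smaller one. *)
    have "signed_swap c d = signed_reflection \<bar>c\<bar> \<bar>d\<bar> \<or> signed_swap c d = signed_reflection \<bar>d\<bar> \<bar>c\<bar>"
    proof (cases "c < 0"; cases "d < 0")
      assume "c < 0" "d < 0"
      then show ?thesis using cd neg by (simp add: signed_reflection_def)
    next
      assume "c < 0" "\<not> d < 0"
      then show ?thesis using cd by (simp add: signed_reflection_def signed_swap_commute)
    next
      assume "\<not> c < 0" "d < 0"
      then show ?thesis using cd neg by (simp add: signed_reflection_def signed_swap_commute)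
    next
      assume "\<not> c < 0" "\<not> d < 0"
      then show ?thesis using cd by (simp add: signed_reflection_def)
    qed
    moreover have "\<bar>c\<bar> \<in> {1..int n}" "\<bar>d\<bar> \<in> {1..int n}"
      using cd by (auto simp: signed_set_def)
    ultimately show ?thesis
      unfolding signed_reflections_def by force
  qed
  show ?thesis
  proof (cases "\<bar>a\<bar> < \<bar>b\<bar>")
    case True
    then show ?thesis using ordered assms by simp
  next
    case False
    then have "\<bar>b\<bar> < \<bar>a\<bar>" using assms(3) by simp
    then show ?thesis using ordered[of b a] assms by (simp add: signed_swap_commute[of a b])
  qed
qed

lemma signed_perm_minus:
  assumes "w \<in> carrier (signed_sym_group n)"
  shows "w (- a) = - w a"
proof (cases "a \<in> signed_set n")
  case True
  with assms show ?thesis by (simp add: signed_sym_group_def)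
next
  case False
  then have "- a \<notin> signed_set n" by (auto simp: signed_set_def)
  moreover have "w permutes signed_set n" using assms by (simp add: signed_sym_group_def)
  ultimately show ?thesis using False by (metis permutes_not_in)
qed

lemma signed_perm_permutes:
  "w \<in> carrier (signed_sym_group n) \<Longrightarrow> w permutes signed_set n"
  by (simp add: signed_sym_group_def)

lemma signed_perm_inv:
  assumes w: "w \<in> carrier (signed_sym_group n)"
  shows "inv' w \<in> carrier (signed_sym_group n)"
proof -
  have p: "w permutes signed_set n" using w by (rule signed_perm_permutes)
  have "inv' w (- a) = - inv' w a" for a
    using signed_perm_minus[OF w, of "inv' w a"] permutes_inverses[OF p] by (metis)
  with permutes_inv[OF p] show ?thesis by (simp add: signed_sym_group_def)
qed

text \<open>The map \<open>i \<mapsto> - w i\<close> is a bijection from the positive \<open>i\<close> with \<open>w i < 0\<close> to the positive \<open>j\<close>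
  sent to a negative number by the inverse of \<open>w\<close>, so \<open>w\<close> and its inverse have equally many sign
  changes. Hence the inverse in \<open>D\<^sub>n\<close> is the inverse map, and conjugation can be computed in \<open>B\<^sub>n\<close>.\<close>

lemma even_signed_perm_inv:
  assumes w: "w \<in> carrier (even_signed_sym_group n)"
  shows "inv' w \<in> carrier (even_signed_sym_group n)"
proof -
  have wB: "w \<in> carrier (signed_sym_group n)"
    and ev: "even (card {i\<in>{1..int n}. w i < 0})"
    using w by (auto simp: even_signed_sym_group_def)
  have maps: "- v i \<in> {j\<in>{1..int n}. inv' v j < 0}"
    if v: "v \<in> carrier (signed_sym_group n)" and i: "i \<in> {i\<in>{1..int n}. v i < 0}" for v i
  proof -
    have p: "v permutes signed_set n" using v by (rule signed_perm_permutes)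
    have "v i \<in> signed_set n"
      unfolding permutes_in_image[OF p] using i by (auto simp: signed_set_def)
    moreover have "inv' v (- v i) = - i"
      using signed_perm_minus[OF signed_perm_inv[OF v]] permutes_inverses[OF p] by simp
    ultimately show ?thesis using i by (auto simp: signed_set_def)
  qed
  have p: "w permutes signed_set n" using wB by (rule signed_perm_permutes)
  have invinv: "inv' (inv' w) = w" using p by (rule permutes_inv_inv)
  have "bij_betw (\<lambda>i. - w i) {i\<in>{1..int n}. w i < 0} {j\<in>{1..int n}. inv' w j < 0}"
  proof (rule bij_betw_byWitness[where f' = "\<lambda>j. - inv' w j"])
    show "(\<lambda>j. - inv' w j) ` {j\<in>{1..int n}. inv' w j < 0} \<subseteq> {i\<in>{1..int n}. w i < 0}"
      using maps[OF signed_perm_inv[OF wB], unfolded invinv] by (rule image_subsetI)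
    show "(\<lambda>i. - w i) ` {i\<in>{1..int n}. w i < 0} \<subseteq> {j\<in>{1..int n}. inv' w j < 0}"
      by (rule image_subsetI) (rule maps[OF wB])
  qed (simp_all add: signed_perm_minus[OF wB] signed_perm_minus[OF signed_perm_inv[OF wB]]
      permutes_inverses[OF p])
  then have "card {j\<in>{1..int n}. inv' w j < 0} = card {i\<in>{1..int n}. w i < 0}"
    by (rule bij_betw_same_card[symmetric])
  with ev signed_perm_inv[OF wB] show ?thesis by (simp add: even_signed_sym_group_def)
qed

lemma conj_sign_change_in_signed_reflections:
  assumes w: "w \<in> carrier (signed_sym_group n)" and a: "a \<in> signed_set n"
  shows "w \<circ> transpose a (- a) \<circ> inv' w \<in> signed_reflections n"
proof -
  have p: "w permutes signed_set n" using w by (rule signed_perm_permutes)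
  have "w a \<in> signed_set n" using a by (simp add: permutes_in_image[OF p])
  then show ?thesis
    using sign_change_in_signed_reflections
    by (simp add: bij_conj_transpose[OF permutes_bij[OF p]] signed_perm_minus[OF w])
qed

lemma conj_signed_swap_in_signed_reflections:
  assumes w: "w \<in> carrier (signed_sym_group n)"
    and ab: "a \<in> signed_set n" "b \<in> signed_set n" "\<bar>a\<bar> \<noteq> \<bar>b\<bar>"
  shows "w \<circ> signed_swap a b \<circ> inv' w \<in> signed_reflections n"
proof -
  have p: "w permutes signed_set n" using w by (rule signed_perm_permutes)
  have bij: "bij w" using p by (rule permutes_bij)
  have eq: "w \<circ> signed_swap a b \<circ> inv' w = signed_swap (w a) (w b)"
    unfolding signed_swap_def conj_comp[OF bij] bij_conj_transpose[OF bij] signed_perm_minus[OF w] ..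
  have "w a \<in> signed_set n" "w b \<in> signed_set n"
    using ab by (simp_all add: permutes_in_image[OF p])
  moreover have "\<bar>w a\<bar> \<noteq> \<bar>w b\<bar>"
    using ab(3) inj_eq[OF bij_is_inj[OF bij], of a b] inj_eq[OF bij_is_inj[OF bij], of a "- b"]
    by (auto simp: abs_eq_iff signed_perm_minus[OF w])
  ultimately show ?thesis
    unfolding eq by (rule signed_swap_in_signed_reflections)
qed

lemma reflections_signed_sym_group:
  assumes "n \<ge> 1"
  shows "cox_reflections (signed_sym_group n) (signed_sym_gens n) \<subseteq> signed_reflections n"
proof
  fix t assume "t \<in> cox_reflections (signed_sym_group n) (signed_sym_gens n)"
  then obtain w s where w: "w \<in> carrier (signed_sym_group n)" and s: "s \<in> signed_sym_gens n"
    and "t = w \<circ> s \<circ> m_inv (signed_sym_group n) w"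
    by (auto simp: cox_reflections_def signed_sym_group_def)
  moreover have "m_inv (signed_sym_group n) w = inv' w"
    using signed_perm_inv[OF w] permutes_bij[OF signed_perm_permutes[OF w]]
    by (intro m_inv_comp_eq_inv) (auto simp: signed_sym_group_def)
  ultimately have t: "t = w \<circ> s \<circ> inv' w" by simp
  from s consider "s = transpose 1 (- 1)"
    | i where "s = signed_swap i (i + 1)" "1 \<le> i" "i \<le> int n - 1"
    by (auto simp: signed_sym_gens_def signed_adj_eq_signed_swap)
  then show "t \<in> signed_reflections n"
  proof cases
    case 1
    then show ?thesis
      unfolding t using assms conj_sign_change_in_signed_reflections[OF w, of 1]
      by (simp add: signed_set_def)
  next
    case 2
    then show ?thesis
      unfolding t using conj_signed_swap_in_signed_reflections[OF w, of i "i + 1"]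
      by (simp add: signed_set_def)
  qed
qed

lemma reflections_even_signed_sym_group:
  assumes "n \<ge> 2"
  shows "cox_reflections (even_signed_sym_group n) (even_signed_sym_gens n) \<subseteq> signed_reflections n"
proof
  fix t assume "t \<in> cox_reflections (even_signed_sym_group n) (even_signed_sym_gens n)"
  then obtain w s where wD: "w \<in> carrier (even_signed_sym_group n)"
    and s: "s \<in> even_signed_sym_gens n"
    and "t = w \<circ> s \<circ> m_inv (even_signed_sym_group n) w"
    by (auto simp: cox_reflections_def even_signed_sym_group_def)
  moreover have w: "w \<in> carrier (signed_sym_group n)"
    using wD by (simp add: even_signed_sym_group_def)
  moreover have "m_inv (even_signed_sym_group n) w = inv' w"
    using even_signed_perm_inv[OF wD] permutes_bij[OF signed_perm_permutes[OF w]]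
    by (intro m_inv_comp_eq_inv) (auto simp: even_signed_sym_group_def)
  ultimately have t: "t = w \<circ> s \<circ> inv' w" by simp
  from s consider "s = signed_swap 1 (- 2)"
    | i where "s = signed_swap i (i + 1)" "1 \<le> i" "i \<le> int n - 1"
    by (auto simp: even_signed_sym_gens_def signed_adj_eq_signed_swap signed_swap_def)
  then show "t \<in> signed_reflections n"
  proof cases
    case 1
    then show ?thesis
      unfolding t using assms conj_signed_swap_in_signed_reflections[OF w, of 1 "- 2"]
      by (simp add: signed_set_def)
  next
    case 2
    then show ?thesis
      unfolding t using conj_signed_swap_in_signed_reflections[OF w, of i "i + 1"]
      by (simp add: signed_set_def)
  qed
qed

lemma degree_H_B:
  assumes "n \<ge> 1"
  shows "finite (nbrs (H_B n) v)" and "card (nbrs (H_B n) v) \<le> n * n"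
proof -
  note * = card_nbrs_bruhat_hasse[OF _ reflections_signed_sym_group[OF assms]
      signed_reflections_involutory finite_signed_reflections card_signed_reflections_le]
  show "finite (nbrs (H_B n) v)" and "card (nbrs (H_B n) v) \<le> n * n"
    unfolding H_B_def by (rule *; simp add: signed_sym_group_def)+
qed

lemma degree_H_D:
  assumes "n \<ge> 2"
  shows "finite (nbrs (H_D n) v)" and "card (nbrs (H_D n) v) \<le> n * n"
proof -
  note * = card_nbrs_bruhat_hasse[OF _ reflections_even_signed_sym_group[OF assms]
      signed_reflections_involutory finite_signed_reflections card_signed_reflections_le]
  show "finite (nbrs (H_D n) v)" and "card (nbrs (H_D n) v) \<le> n * n"
    unfolding H_D_def by (rule *; simp add: even_signed_sym_group_def)+
qed

section \<open>Curvature bounds for types A, B and D\<close>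

theorem theorem19:
  shows "(\<forall>n::nat. 2 \<le> n \<longrightarrow>
            Ric (H_A n) \<ge> ereal (- of_int \<lfloor>(real n)\<^sup>2 / 2\<rfloor> - 2 * real n + 8)) \<and>
         (\<forall>n::nat. 2 \<le> n \<and> n \<le> 5 \<longrightarrow>
            Ric (H_B n) \<ge> ereal (4 * (- 2 * real n + 1))) \<and>
         (\<forall>n::nat. 5 \<le> n \<longrightarrow>
            Ric (H_B n) \<ge> ereal (- 2 * of_int \<lfloor>(real n)\<^sup>2 / 2\<rfloor> - 2 * real n + 6)) \<and>
         (\<forall>n::nat. 3 \<le> n \<longrightarrow>
            Ric (H_D n) \<ge> ereal (- 2 * of_int \<lfloor>(real n)\<^sup>2 / 2\<rfloor> - 2 * real n + 6))"
proof -
  have floor: "real_of_int \<lfloor>r\<rfloor> > r - 1" for r :: real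
    by linarith
  have A: "curvature_ge (H_A n) (- of_int \<lfloor>(real n)\<^sup>2 / 2\<rfloor> - 2 * real n + 8)"
    if n: "2 \<le> n" for n :: nat
  proof (cases "n = 2")
    case True
    have "curvature_ge (H_A n) 2"
      using degree_H_A[of n] True by (intro curvature_ge_two_of_degree_le_1) auto
    with True show ?thesis by simp
  next
    case False
    define F where "F = real_of_int \<lfloor>(real n)\<^sup>2 / 2\<rfloor>"
    have "real (n choose 2) = real n * (real n - 1) / 2"
      using n by (simp add: choose_two real_of_nat_div of_nat_diff)
    then have "real (n choose 2) = (real n)\<^sup>2 / 2 - real n / 2"
      by (simp add: power2_eq_square algebra_simps diff_divide_distrib)
    moreover have "real n \<ge> 3" using n False by simp
    moreover have "F > (real n)\<^sup>2 / 2 - 1" unfolding F_def by (rule floor)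
    ultimately have "- of_int \<lfloor>(real n)\<^sup>2 / 2\<rfloor> - 2 * real n + 8 \<le> 2 - real (n choose 2)"
      unfolding F_def[symmetric] by linarith
    then show ?thesis
      by (intro curvature_ge_two_minus_degree[OF degree_H_A])
  qed
  have BD: "- 2 * of_int \<lfloor>(real n)\<^sup>2 / 2\<rfloor> - 2 * real n + 6 \<le> 2 - real (n * n)"
    if "3 \<le> n" for n :: nat
  proof -
    define F where "F = real_of_int \<lfloor>(real n)\<^sup>2 / 2\<rfloor>"
    have "real (n * n) = (real n)\<^sup>2" by (simp add: power2_eq_square)
    moreover have "real n \<ge> 3" using that by simp
    moreover have "F > (real n)\<^sup>2 / 2 - 1" unfolding F_def by (rule floor)
    ultimately show ?thesis
      unfolding F_def[symmetric] by linarith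
  qed
  have B: "curvature_ge (H_B n) (4 * (- 2 * real n + 1))" if n: "2 \<le> n" "n \<le> 5" for n :: nat
  proof -
    have small: "4 * (- 2 * r + 1) \<le> 2 - r * r" if "2 \<le> r" "r \<le> 5" for r :: real
    proof -
      have "r * r + 2 \<le> 5 * r + 2"
        using that by (intro add_right_mono mult_right_mono) auto
      also have "\<dots> \<le> 8 * r" using that by simp
      finally show ?thesis by (simp add: algebra_simps)
    qed
    have "4 * (- 2 * real n + 1) \<le> 2 - real (n * n)"
      using small[of "real n"] n by simp
    then show ?thesis
      using n by (intro curvature_ge_two_minus_degree[OF degree_H_B]) auto
  qed
  have B': "curvature_ge (H_B n) (- 2 * of_int \<lfloor>(real n)\<^sup>2 / 2\<rfloor> - 2 * real n + 6)"
    if "5 \<le> n" for n :: nat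
    by (rule curvature_ge_two_minus_degree[OF degree_H_B BD]) (use that in auto)
  have D: "curvature_ge (H_D n) (- 2 * of_int \<lfloor>(real n)\<^sup>2 / 2\<rfloor> - 2 * real n + 6)"
    if "3 \<le> n" for n :: nat
    by (rule curvature_ge_two_minus_degree[OF degree_H_D BD]) (use that in auto)
  show ?thesis
    using A B B' D by (simp add: curvature_ge_iff_le_Ric)
qed

end
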